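(* Let $\mathcal{C}\subseteq\mathbb{R}^d$ be a simplex-like polytope of diameter $\delta>0$ and let $f\colon\mathcal{C}\to\mathbb{R}$ be a convex and $L$-smooth function with unique minimizer $x^*\in\operatorname{argmin}_{x\in\mathcal{C}}f(x)$ satisfying a $(\mu,\theta)$-Hölderian error bound for some $\mu>0$ and $\theta\in[0,1/2]$. Let $T\in\mathbb{N}$ and $\eta_t=\frac{8}{t+8}$ for all $t\in\mathbb{Z}$. Then, for the iterates $x_t$ of the decomposition-invariant pairwise Frank-Wolfe algorithm (DIFW) with open-loop step-size $\eta_t$, with $h_t=f(x_t)-f(x^* )$, it holds that $$h_t\le\max\left\{\eta_{t-2}^{1/(1-\theta)}\frac{L\delta^2}{2},\ \left(\eta_{t-2}\,2\mu L\delta^2\sqrt{|\operatorname{supp}(x^* )|}\right)^{1/(1-\theta)}+\eta_{t-2}^2\frac{L\delta^2}{2}\right\}$$ for all $t\in\{1,\ldots,T\}$.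
   Context: Simplex-like polytope: a polytope $\mathcal{C}\subseteq\mathbb{R}^d$ that can be described as $\mathcal{C}=\{x\in\mathbb{R}^d\mid x\ge0,\ Ax=b\}$ for some $A\in\mathbb{R}^{m\times d}$, $b\in\mathbb{R}^m$, $m\in\mathbb{N}$, and all of whose vertices lie on the Boolean hypercube $\{0,1\}^d$. DIFW: given $x_0\in\mathcal{C}$ and step-sizes $\eta_t\in[0,1]$, let $x_1\in\operatorname{argmin}_{p\in\mathcal{C}}\langle\nabla f(x_0),p-x_0\rangle$. For $t=1,\ldots,T-1$: (1) let $p_t^+\in\operatorname{argmin}_{p\in\mathcal{C}}\langle\nabla f(x_t),p-x_t\rangle$; (2) define $\tilde\nabla f(x_t)$ entrywise by $(\tilde\nabla f(x_t))_i=(\nabla f(x_t))_i$ if $(x_t)_i>0$ and $(\tilde\nabla f(x_t))_i=-\infty$ if $(x_t)_i=0$; (3) let $p_t^-\in\operatorname{argmin}_{p\in\mathcal{C}}\langle-\tilde\nabla f(x_t),p-x_t\rangle$ (with the convention $\infty\cdot0=0$; i.e. $p_t^-$ maximizes $\langle\nabla f(x_t),p\rangle$ over points $p\in\mathcal{C}$ with $\operatorname{supp}(p)\subseteq\operatorname{supp}(x_t)$); (4) let $\delta_t$ be the smallest natural number (possibly $0$) such that $2^{-\delta_t}\le\eta_t$ and set $\gamma_t=2^{-\delta_t}$; (5) set $x_{t+1}=x_t+\gamma_t(p_t^+-p_t^-)$. The linear minimizations always return vertices of $\mathcal{C}$ (so $x_1,p_t^+,p_t^-$ are vertices). $\operatorname{supp}(x)=\{i\mid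 x_i\ne0\}$. $L$-smooth ($L>0$): $f$ is differentiable in an open set containing $\mathcal{C}$ and $f(y)\le f(x)+\langle\nabla f(x),y-x\rangle+\frac{L}{2}\|x-y\|_2^2$ for all $x,y\in\mathcal{C}$. $(\mu,\theta)$-Hölderian error bound (with unique minimizer $x^*$ of $f$ over $\mathcal{C}$): $\mu(f(x)-f(x^* ))^\theta\ge\|x-x^*\|_2$ for all $x\in\mathcal{C}$. The diameter is with respect to $\|\cdot\|_2$. *)

theory Defs
  imports "HOL-Analysis.Analysis"
begin

definition argmins :: "('a \<Rightarrow> 'b::ord) \<Rightarrow> 'a set \<Rightarrow> 'a set" where
  "argmins f S = {x. is_arg_min f (\<lambda>y. y \<in> S) x}"

definition vertices :: "'a::real_vector set \<Rightarrow> 'a set" where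
  "vertices C = {v. v extreme_point_of C}"

definition vec_supp :: "real ^ 'n \<Rightarrow> 'n set" where
  "vec_supp x = {i. x $ i \<noteq> 0}"

text \<open>The system \<open>A x = b\<close> is given by the rows \<open>A 0, \<dots>, A (m - 1)\<close> of the matrix, so that the
  number \<open>m\<close> of equations can be quantified inside the definition.\<close>

definition simplex_like :: "(real ^ 'n) set \<Rightarrow> bool" where
  "simplex_like C \<longleftrightarrow>
     polytope C \<and>
     (\<exists>(m::nat) (A :: nat \<Rightarrow> real ^ 'n) (b :: nat \<Rightarrow> real).
        C = {x. (\<forall>i. 0 \<le> x $ i) \<and> (\<forall>j<m. A j \<bullet> x = b j)}) \<and>
     (\<forall>v \<in> vertices C. \<forall>i. v $ i \<in> {0, 1})"

text \<open>Meaningful only where \<open>f\<close> is differentiable.\<close>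

definition gradient :: "('a::real_inner \<Rightarrow> real) \<Rightarrow> 'a \<Rightarrow> 'a" where
  "gradient f x = (THE g. GDERIV f x :> g)"

definition L_smooth_on :: "'a::euclidean_space set \<Rightarrow> real \<Rightarrow> ('a \<Rightarrow> real) \<Rightarrow> bool" where
  "L_smooth_on C L f \<longleftrightarrow>
     L > 0 \<and>
     (\<exists>U. open U \<and> C \<subseteq> U \<and> (\<forall>x\<in>U. f differentiable (at x))) \<and>
     (\<forall>x\<in>C. \<forall>y\<in>C. f y \<le> f x + gradient f x \<bullet> (y - x) + L / 2 * (norm (x - y))\<^sup>2)"

text \<open>\<open>0 powr 0 = 0\<close> in Isabelle/HOL; with \<open>\<theta> = 0\<close> this only concerns points \<open>x\<close> with
  \<open>f x = f xs\<close>. If \<open>xs\<close> is the unique minimizer, then \<open>x = xs\<close> and the inequality holds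
  under either convention for \<open>0\<^sup>0\<close>.\<close>

definition holder_error_bound ::
  "'a::real_normed_vector set \<Rightarrow> ('a \<Rightarrow> real) \<Rightarrow> 'a \<Rightarrow> real \<Rightarrow> real \<Rightarrow> bool" where
  "holder_error_bound C f xs \<mu> \<theta> \<longleftrightarrow>
     (\<forall>x\<in>C. \<mu> * (f x - f xs) powr \<theta> \<ge> norm (x - xs))"

definition masked_gradient :: "(real ^ 'n \<Rightarrow> real) \<Rightarrow> real ^ 'n \<Rightarrow> 'n \<Rightarrow> ereal" where
  "masked_gradient f x i = (if x $ i > 0 then ereal (gradient f x $ i) else - \<infinity>)"

text \<open>For \<open>x, p \<ge> 0\<close> the inner product below never adds infinities of opposite sign:
  the infinite coefficients of \<open>- masked_gradient f x\<close> are all \<open>\<infinity>\<close> and are multiplied by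
  \<open>p $ i \<ge> 0\<close>. Multiplication on \<^typ>\<open>ereal\<close> satisfies \<open>\<infinity> * 0 = 0\<close>.\<close>

definition away_objective :: "(real ^ 'n \<Rightarrow> real) \<Rightarrow> real ^ 'n \<Rightarrow> real ^ 'n \<Rightarrow> ereal" where
  "away_objective f x p = (\<Sum>i\<in>UNIV. (- masked_gradient f x i) * ereal (p $ i - x $ i))"

definition dyadic_step :: "real \<Rightarrow> real" where
  "dyadic_step \<eta> = (1 / 2) ^ (LEAST k::nat. (1 / 2) ^ k \<le> \<eta>)"

text \<open>\<open>x\<close> is a possible sequence of iterates of DIFW: ties in the linear minimizations may be
  broken arbitrarily, but a vertex is always returned. The values of \<open>x\<close> beyond index
  \<open>max 1 T\<close> are unconstrained.\<close>

definition difw_iterates ::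
  "(real ^ 'n) set \<Rightarrow> (real ^ 'n \<Rightarrow> real) \<Rightarrow> (nat \<Rightarrow> real) \<Rightarrow> nat \<Rightarrow> (nat \<Rightarrow> real ^ 'n) \<Rightarrow> bool" where
  "difw_iterates C f \<eta> T x \<longleftrightarrow>
     x 0 \<in> C \<and>
     x 1 \<in> vertices C \<inter> argmins (\<lambda>p. gradient f (x 0) \<bullet> (p - x 0)) C \<and>
     (\<forall>t\<in>{1..<T}.
        \<exists>p_plus \<in> vertices C \<inter> argmins (\<lambda>p. gradient f (x t) \<bullet> (p - x t)) C.
        \<exists>p_minus \<in> vertices C \<inter> argmins (away_objective f (x t)) C.
          x (t + 1) = x t + dyadic_step (\<eta> t) *\<^sub>R (p_plus - p_minus))"

end

theory Submission
  imports Defs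
begin

text \<open>
  Two points \<open>x, y\<close> of a simplex-like polytope differ by \<open>x - y = r (z - q)\<close> with \<open>z, q\<close> in the
  polytope, \<open>r z \<le> x\<close> and \<open>r \<le> sqrt |supp y| * ||x - y||\<close>. Applied to an iterate and to the
  minimizer, together with the error bound, this shows that the pairwise gap \<open>G\<close> satisfies
  \<open>h \<le> G\<close> and \<open>h\<^sup>1\<^sup>-\<^sup>\<theta> \<le> \<mu> sqrt |supp xs| * G\<close>. Smoothness gives
  \<open>h' \<le> h - \<gamma> G + \<gamma>\<^sup>2 M\<close> with \<open>M = L \<delta>\<^sup>2 / 2\<close> and \<open>\<eta>/2 \<le> \<gamma> \<le> \<eta>\<close>. So either \<open>h\<close> is already
  of order \<open>\<eta>\<close> to the power \<open>1 / (1 - \<theta>)\<close>, or \<open>G\<close> dominates the quadratic term and \<open>h\<close>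
  contracts by the factor \<open>1 - \<eta>\<^sub>t / 4 = \<eta>\<^sub>t / \<eta>\<^sub>t\<^sub>-\<^sub>2\<close>. This factor is the quotient of two consecutive
  values of \<open>\<eta>\<^sub>t\<^sub>-\<^sub>1 \<eta>\<^sub>t\<^sub>-\<^sub>2\<close>, so the induction is carried out with \<open>\<eta>\<^sub>t\<^sub>-\<^sub>1 \<eta>\<^sub>t\<^sub>-\<^sub>2\<close> in place of
  \<open>(\<eta>\<^sub>t\<^sub>-\<^sub>2)\<^sup>2\<close>; with the latter it would not close.
\<close>

section \<open>Basic facts on simplex-like polytopes\<close>

lemma simplex_like_nonneg:
  assumes "simplex_like C" "x \<in> C"
  shows "0 \<le> x $ i"
  using assms unfolding simplex_like_def by blast

lemma simplex_like_vertex: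
  assumes "simplex_like C" "v \<in> vertices C"
  shows "v \<in> C" "v $ i = 0 \<or> v $ i = 1"
proof -
  show "v \<in> C"
    using assms(2) by (simp add: vertices_def extreme_point_of_def)
  have "\<forall>v\<in>vertices C. \<forall>i. v $ i \<in> {0, 1}"
    using assms(1) unfolding simplex_like_def by (elim conjE)
  with assms(2) show "v $ i = 0 \<or> v $ i = 1"
    by simp
qed

text \<open>The equations \<open>A j \<bullet> x = b j\<close> hold at \<open>x\<close>,
  \<open>u\<close> and \<open>v\<close>, so adding a multiple of \<open>u - v\<close> preserves
  them. Only the signs of the coordinates decide feasibility.\<close>

lemma simplex_like_shift:
  assumes "simplex_like C" "x \<in> C" "u \<in> C" "v \<in> C"
    and nonneg: "\<And>i. 0 \<le> (x + r *\<^sub>R (u - v)) $ i"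
  shows "x + r *\<^sub>R (u - v) \<in> C"
proof -
  obtain m A b where
    C: "C = {x. (\<forall>i. 0 \<le> x $ i) \<and> (\<forall>j<(m::nat). A j \<bullet> x = b j)}"
    using assms(1) unfolding simplex_like_def by blast
  have "A j \<bullet> (x + r *\<^sub>R (u - v)) = b j" if "j < m" for j
  proof -
    have "A j \<bullet> x = b j" "A j \<bullet> u = b j" "A j \<bullet> v = b j"
      using assms(2-4) that by (simp_all add: C)
    then show ?thesis by (simp add: inner_add_right inner_diff_right)
  qed
  with nonneg show ?thesis
    by (simp add: C)
qed

lemma simplex_like_vertex_combination:
  assumes "simplex_like C" "q \<in> C"
  obtains w where "finite (vertices C)" "\<And>v. v \<in> vertices C \<Longrightarrow> 0 \<le> w v"
    "(\<Sum>v\<in>vertices C. w v) = 1" "q = (\<Sum>v\<in>vertices C. w v *\<^sub>R v)"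
proof -
  have "polytope C"
    using assms(1) by (simp add: simplex_like_def)
  then have fin: "finite (vertices C)"
    unfolding vertices_def by (intro finite_polyhedron_extreme_points polytope_imp_polyhedron)
  have "C = convex hull (vertices C)"
    unfolding vertices_def using \<open>polytope C\<close>
    by (intro Krein_Milman_Minkowski polytope_imp_compact polytope_imp_convex)
  with assms(2) have "q \<in> convex hull (vertices C)"
    by blast
  then obtain w where "\<forall>v\<in>vertices C. 0 \<le> w v" "sum w (vertices C) = 1"
      "(\<Sum>v\<in>vertices C. w v *\<^sub>R v) = q"
    unfolding convex_hull_finite[OF fin] by auto
  then show ?thesis
    using that[of w] fin by simp
qed

section \<open>Exchange decomposition of the difference of two points\<close>

lemma sum_le_sqrt_card_norm:
  fixes d :: "real ^ 'n"
  assumes "J \<subseteq> K"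
  shows "(\<Sum>j\<in>J. d $ j) \<le> sqrt (real (card K)) * norm d"
proof -
  have "(\<Sum>j\<in>J. d $ j) \<le> (\<Sum>j\<in>J. \<bar>1\<bar> * \<bar>d $ j\<bar>)"
    by (intro sum_mono) simp
  also have "\<dots> \<le> L2_set (\<lambda>_. 1) J * L2_set (($) d) J"
    by (rule L2_set_mult_ineq)
  also have "\<dots> \<le> sqrt (real (card K)) * norm d"
  proof (intro mult_mono)
    show "L2_set (\<lambda>_. 1) J \<le> sqrt (real (card K))"
      using assms by (simp add: L2_set_def card_mono)
    show "L2_set (($) d) J \<le> norm d"
      unfolding norm_vec_def L2_set_def
      by (auto intro!: real_sqrt_le_mono sum_mono2)
  qed (auto simp: L2_set_nonneg)
  finally show ?thesis .
qed

text \<open>Mass \<open>r\<close> is moved from \<open>z\<close> to \<open>q\<close> to turn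
  \<open>x\<close> into \<open>y\<close>; the last condition says that \<open>x\<close> really
  contains the mass removed. Restricting \<open>r\<close> to \<open>{0..1}\<close> makes the set of
  exchanges compact for compact \<open>C\<close>.\<close>

definition is_exchange ::
  "(real ^ 'n) set \<Rightarrow> real ^ 'n \<Rightarrow> real ^ 'n \<Rightarrow> real \<Rightarrow> real ^ 'n \<Rightarrow> real ^ 'n \<Rightarrow> bool" where
  "is_exchange C x y r z q \<longleftrightarrow>
     r \<in> {0..1} \<and> z \<in> C \<and> q \<in> C \<and> x - y = r *\<^sub>R (z - q) \<and> (\<forall>i. r * z $ i \<le> x $ i)"

text \<open>The exchanges form a closed subset of the compact set
  \<open>{0..1} \<times> C \<times> C\<close>, nonempty because it contains
  \<open>(1, x, y)\<close>, so the first coordinate attains its minimum.\<close>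

lemma minimal_exchange:
  assumes "compact C" "x \<in> C" "y \<in> C"
  obtains r z q where "is_exchange C x y r z q"
    "\<And>r' z' q'. is_exchange C x y r' z' q' \<Longrightarrow> r \<le> r'"
proof -
  define S where "S = ({0..1::real} \<times> C \<times> C) \<inter>
      {w. x - y = fst w *\<^sub>R (fst (snd w) - snd (snd w)) \<and> (\<forall>i. fst w * fst (snd w) $ i \<le> x $ i)}"
  have S_iff: "(r, z, q) \<in> S \<longleftrightarrow> is_exchange C x y r z q" for r z q
    by (auto simp: S_def is_exchange_def)
  have "closed {w::real \<times> (real ^ 'a) \<times> (real ^ 'a).
      x - y = fst w *\<^sub>R (fst (snd w) - snd (snd w)) \<and> (\<forall>i. fst w * fst (snd w) $ i \<le> x $ i)}"
    by (intro closed_Collect_conj closed_Collect_eq closed_Collect_all closed_Collect_le continuous_intros)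
  then have "compact S"
    unfolding S_def using \<open>compact C\<close> by (intro compact_Int_closed compact_Times) auto
  moreover have "(1, x, y) \<in> S"
    using assms by (simp add: S_def)
  moreover have "continuous_on S fst"
    by (intro continuous_intros)
  ultimately obtain w where w: "w \<in> S" "\<And>w'. w' \<in> S \<Longrightarrow> fst w \<le> fst w'"
    using continuous_attains_inf[of S fst] by blast
  obtain r z q where rzq: "w = (r, z, q)"
    by (cases w) auto
  show ?thesis
  proof (rule that)
    show "is_exchange C x y r z q"
      using w(1) by (simp add: rzq S_iff)
    show "r \<le> r'" if "is_exchange C x y r' z' q'" for r' z' q'
      using w(2)[of "(r', z', q')"] that by (simp add: rzq S_iff)
  qed
qed

text \<open>Choose \<open>r\<close> minimal. If \<open>r > 0\<close>, then \<open>z\<close> and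
  \<open>q\<close> have no common part, which forces \<open>q\<close> to have total mass at least 1
  on coordinates where \<open>z\<close> vanishes. There \<open>r q\<close> equals
  \<open>y - x\<close>, and Cauchy-Schwarz bounds \<open>r\<close>.\<close>

lemma simplex_like_exchange:
  assumes "simplex_like C" "x \<in> C" "y \<in> C"
  obtains r z q where "0 \<le> r" "z \<in> C" "q \<in> C" "x - y = r *\<^sub>R (z - q)" "\<And>i. r * z $ i \<le> x $ i"
    "r \<le> sqrt (real (card (vec_supp y))) * norm (x - y)"
proof -
  have "compact C"
    using assms(1) by (simp add: simplex_like_def polytope_imp_compact)
  obtain r z q where exch: "is_exchange C x y r z q"
    and minimal: "\<And>r' z' q'. is_exchange C x y r' z' q' \<Longrightarrow> r \<le> r'"
    using minimal_exchange[OF \<open>compact C\<close> assms(2,3)] by metis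
  have rzq: "0 \<le> r" "z \<in> C" "q \<in> C" "x - y = r *\<^sub>R (z - q)" "\<And>i. r * z $ i \<le> x $ i"
    and "r \<le> 1"
    using exch by (auto simp: is_exchange_def)
  have comp: "x $ i - y $ i = r * (z $ i - q $ i)" for i
    using arg_cong[OF rzq(4), of "\<lambda>v. v $ i"] by simp
  have nonneg: "0 \<le> u $ i" if "u \<in> C" for u i
    using simplex_like_nonneg[OF assms(1) that] .
  have "r \<le> sqrt (real (card (vec_supp y))) * norm (x - y)"
  proof (cases "r = 0")
    case False
    then have "0 < r" using rzq(1) by simp
    \<comment> \<open>If \<open>z\<close> and \<open>q\<close> both dominated a positive multiple of \<open>u\<close>, removing it from both would
      give an exchange with smaller \<open>r\<close>.\<close>
    have separated: "\<exists>j. 0 < u $ j \<and> (z $ j = 0 \<or> q $ j = 0)" if "u \<in> C" for u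
    proof (rule ccontr)
      assume "\<not> ?thesis"
      then have pos: "0 < z $ j \<and> 0 < q $ j" if "0 < u $ j" for j
        using that nonneg[OF rzq(2), of j] nonneg[OF rzq(3), of j] by fastforce
      \<comment> \<open>\<open>e\<close> is chosen so that \<open>e u\<close> lies below both
        \<open>z\<close> and \<open>q\<close>. The extra entry \<open>1/2\<close> keeps the set
        nonempty and \<open>1 - e\<close> positive.\<close>
      define e where "e = Min (insert (1/2) ((\<lambda>j. min (z $ j) (q $ j) / u $ j) ` {j. 0 < u $ j}))"
      have "0 < e"
        unfolding e_def using pos by (auto simp: Min_gr_iff)
      have "e \<le> 1/2"
        unfolding e_def by (rule Min_le) auto
      have e: "e * u $ j \<le> z $ j \<and> e * u $ j \<le> q $ j" for j
      proof (cases "0 < u $ j")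
        case True
        then have "e \<le> min (z $ j) (q $ j) / u $ j"
          unfolding e_def by (intro Min_le) auto
        then have "e * u $ j \<le> min (z $ j) (q $ j)"
          using True by (simp add: pos_le_divide_eq)
        then show ?thesis by simp
      next
        case False
        then have "u $ j = 0" using nonneg[OF that, of j] by simp
        then show ?thesis using nonneg rzq(2,3) by simp
      qed
      \<comment> \<open>With this \<open>k\<close>, the point \<open>z + k (z - u)\<close> is
        \<open>(z - e u) / (1 - e)\<close>: the common part is removed and the rest rescaled to
        satisfy the equations again.\<close>
      define k where "k = e / (1 - e)"
      have e1: "0 < 1 - e"
        using \<open>e \<le> 1/2\<close> by simp
      have shift: "(v + k *\<^sub>R (v - u)) $ i = (v $ i - e * u $ i) / (1 - e)" for v i
      proof -
        have "(v + k *\<^sub>R (v - u)) $ i * (1 - e) = v $ i * (1 - e) + (k * (1 - e)) * (v $ i - u $ i)"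
          by (simp add: algebra_simps)
        also have "k * (1 - e) = e"
          using e1 by (simp add: k_def)
        finally show ?thesis
          using e1 by (simp add: eq_divide_eq algebra_simps)
      qed
      have "0 \<le> (v + k *\<^sub>R (v - u)) $ i" if "v = z \<or> v = q" for v i
        unfolding shift using that e[of i] e1 by (intro divide_nonneg_pos) auto
      then have in_C: "z + k *\<^sub>R (z - u) \<in> C" "q + k *\<^sub>R (q - u) \<in> C"
        using simplex_like_shift[OF assms(1)] \<open>u \<in> C\<close> rzq(2,3) by simp_all
      \<comment> \<open>The parts \<open>e u\<close> cancel in the difference of the new points, so
        weight \<open>r (1 - e)\<close> suffices.\<close>
      have "r \<le> r * (1 - e)"
      proof (rule minimal, unfold is_exchange_def, intro conjI allI)
        show "r * (1 - e) \<in> {0..1}"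
          using \<open>r \<le> 1\<close> rzq(1) e1 \<open>0 < e\<close> by (auto intro: mult_le_one)
        show "z + k *\<^sub>R (z - u) \<in> C" "q + k *\<^sub>R (q - u) \<in> C"
          by (fact in_C)+
        show "x - y = (r * (1 - e)) *\<^sub>R (z + k *\<^sub>R (z - u) - (q + k *\<^sub>R (q - u)))"
        proof -
          have key: "(r * (1 - e)) * ((z $ i - e * u $ i) / (1 - e) - (q $ i - e * u $ i) / (1 - e))
              = r * (z $ i - q $ i)" for i
            using e1 by (simp flip: diff_divide_distrib)
          show ?thesis
            unfolding vec_eq_iff vector_minus_component vector_scaleR_component shift comp
            by (simp only: real_scaleR_def key simp_thms)
        qed
        show "r * (1 - e) * (z + k *\<^sub>R (z - u)) $ i \<le> x $ i" for i
        proof -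
          have "r * (1 - e) * (z + k *\<^sub>R (z - u)) $ i = r * z $ i - r * (e * u $ i)"
          proof -
            have "r * (1 - e) * ((z $ i - e * u $ i) / (1 - e)) = r * (z $ i - e * u $ i)"
              using e1 by simp
            then show ?thesis by (simp only: shift right_diff_distrib)
          qed
          also have "\<dots> \<le> r * z $ i"
            using \<open>0 < e\<close> rzq(1) nonneg[OF that, of i] by simp
          finally show ?thesis using rzq(5)[of i] by linarith
        qed
      qed
      then show False
        using mult_pos_pos[OF \<open>0 < r\<close> \<open>0 < e\<close>] by (simp add: right_diff_distrib)
    qed
    \<comment> \<open>By \<open>separated\<close>, each vertex in a convex combination for \<open>q\<close> has an entry 1 inside \<open>J\<close>;
      on \<open>J\<close> the entries of \<open>r q\<close> are those of \<open>y - x\<close>.\<close>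
    define J where "J = {j. z $ j = 0 \<and> 0 < q $ j}"
    obtain w where w: "finite (vertices C)" "\<And>v. v \<in> vertices C \<Longrightarrow> 0 \<le> w v"
      "(\<Sum>v\<in>vertices C. w v) = 1" "q = (\<Sum>v\<in>vertices C. w v *\<^sub>R v)"
      using simplex_like_vertex_combination[OF assms(1) rzq(3)] by metis
    note vC = simplex_like_vertex(1)[OF assms(1)]
    \<comment> \<open>The factor \<open>w v\<close> stays on both sides because a vertex of weight 0
      may miss \<open>J\<close>.\<close>
    have "w v \<le> w v * (\<Sum>j\<in>J. v $ j)" if v: "v \<in> vertices C" for v
    proof (cases "w v = 0")
      case False
      then have wv: "0 < w v" using w(2)[OF v] by simp
      \<comment> \<open>A vertex of positive weight has its support inside that of \<open>q\<close>,
        which excludes the alternative \<open>q $ j = 0\<close> in \<open>separated\<close>.\<close>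
      have q_pos: "0 < q $ j" if "0 < v $ j" for j
      proof -
        have "0 < w v * v $ j" using wv that by simp
        also have "\<dots> \<le> (\<Sum>v\<in>vertices C. w v * v $ j)"
          using w(1,2) v nonneg vC by (intro member_le_sum) auto
        finally show ?thesis using w(4) by (simp add: sum_component)
      qed
      obtain j where j: "0 < v $ j" "z $ j = 0 \<or> q $ j = 0"
        using separated[OF vC[OF v]] by blast
      then have "j \<in> J" using q_pos[of j] by (auto simp: J_def)
      moreover have "v $ j = 1"
        using simplex_like_vertex(2)[OF assms(1) v, of j] j(1) by auto
      ultimately have "1 \<le> (\<Sum>j\<in>J. v $ j)"
        using member_le_sum[of j J "\<lambda>j. v $ j"] nonneg[OF vC[OF v]] by auto
      then show ?thesis using wv by simp
    qed simp
    then have "(\<Sum>v\<in>vertices C. w v) \<le> (\<Sum>v\<in>vertices C. w v * (\<Sum>j\<in>J. v $ j))"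
      by (rule sum_mono)
    also have "\<dots> = (\<Sum>j\<in>J. q $ j)"
      unfolding w(4) by (simp add: sum_component sum_distrib_left sum.swap[of _ J])
    finally have "1 \<le> (\<Sum>j\<in>J. q $ j)"
      using w(3) by simp
    then have "r \<le> (\<Sum>j\<in>J. r * q $ j)"
      using \<open>0 < r\<close> by (simp flip: sum_distrib_left)
    also have "\<dots> = (\<Sum>j\<in>J. (y - x) $ j)"
      using comp by (intro sum.cong) (auto simp: J_def algebra_simps)
    also have "\<dots> \<le> sqrt (real (card (vec_supp y))) * norm (y - x)"
    proof (rule sum_le_sqrt_card_norm)
      show "J \<subseteq> vec_supp y"
      proof
        fix j assume "j \<in> J"
        then have "0 < r * q $ j" "z $ j = 0" using \<open>0 < r\<close> by (simp_all add: J_def)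
        then have "y $ j = x $ j + r * q $ j" using comp[of j] by simp
        then show "j \<in> vec_supp y"
          using \<open>0 < r * q $ j\<close> nonneg[OF assms(2), of j] by (simp add: vec_supp_def)
      qed
    qed
    finally show ?thesis by (simp add: norm_minus_commute)
  qed simp
  then show ?thesis using that[of r z q] rzq by blast
qed

section \<open>The away vertex and the pairwise gap\<close>

lemma in_argmins_iff:
  fixes g :: "'a \<Rightarrow> 'b::linorder"
  shows "p \<in> argmins g S \<longleftrightarrow> p \<in> S \<and> (\<forall>y\<in>S. g p \<le> g y)"
  by (auto simp: argmins_def is_arg_min_def not_less)

text \<open>Where \<open>x\<close> vanishes, so does \<open>p\<close>, and the infinite coefficient
  is multiplied by 0; elsewhere the mask does not act.\<close>

lemma away_objective_finite:
  fixes x p :: "real ^ 'n"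
  assumes "\<And>i. 0 \<le> x $ i" "vec_supp p \<subseteq> vec_supp x"
  shows "away_objective f x p = ereal (gradient f x \<bullet> (x - p))"
proof -
  have "(- masked_gradient f x i) * ereal (p $ i - x $ i) = ereal (gradient f x $ i * (x $ i - p $ i))" for i
  proof (cases "x $ i = 0")
    case True
    then have "p $ i = 0" using assms(2) by (auto simp: vec_supp_def)
    then show ?thesis using True by (simp flip: zero_ereal_def)
  next
    case False
    then have "0 < x $ i" using assms(1)[of i] by simp
    then show ?thesis by (simp add: masked_gradient_def algebra_simps)
  qed
  then show ?thesis
    by (simp add: away_objective_def inner_vec_def)
qed

lemma away_objective_infinite:
  fixes x p :: "real ^ 'n"
  assumes "\<And>i. 0 \<le> x $ i" "\<And>i. 0 \<le> p $ i" "\<not> vec_supp p \<subseteq> vec_supp x"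
  shows "away_objective f x p = \<infinity>"
proof -
  obtain i where "p $ i \<noteq> 0" "x $ i = 0"
    using assms(3) by (auto simp: vec_supp_def)
  then have "(- masked_gradient f x i) * ereal (p $ i - x $ i) = \<infinity>"
    using assms(2)[of i] by (simp add: masked_gradient_def)
  then show ?thesis
    unfolding away_objective_def sum_Pinfty by auto
qed

text \<open>The point \<open>x\<close> itself has a finite objective value, so a minimizer is
  supported in \<open>vec_supp x\<close>. On such points the objective is affine with linear part
  minus the gradient.\<close>

lemma away_vertex:
  assumes "simplex_like C" "x \<in> C" "p \<in> argmins (away_objective f x) C"
  shows "p \<in> C" "vec_supp p \<subseteq> vec_supp x"
    and "\<And>z. \<lbrakk>z \<in> C; vec_supp z \<subseteq> vec_supp x\<rbrakk> \<Longrightarrow> gradient f x \<bullet> z \<le> gradient f x \<bullet> p"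
proof -
  have min: "p \<in> C" "\<And>y. y \<in> C \<Longrightarrow> away_objective f x p \<le> away_objective f x y"
    using assms(3) by (auto simp: in_argmins_iff)
  note nonneg = simplex_like_nonneg[OF assms(1)]
  have val: "away_objective f x z = ereal (gradient f x \<bullet> (x - z))"
    if "vec_supp z \<subseteq> vec_supp x" for z
    using away_objective_finite[OF nonneg[OF assms(2)] that] .
  show "p \<in> C" by fact
  show supp: "vec_supp p \<subseteq> vec_supp x"
    using away_objective_infinite[OF nonneg[OF assms(2)] nonneg[OF min(1)], of f]
      min(2)[OF assms(2)] val[of x] by force
  show "gradient f x \<bullet> z \<le> gradient f x \<bullet> p" if "z \<in> C" "vec_supp z \<subseteq> vec_supp x" for z
    using min(2)[OF that(1)] val[OF that(2)] val[OF supp] by (simp add: inner_diff_right)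
qed

text \<open>Both bounds compare \<open>(v, p)\<close> with a competing pair: \<open>(x, y)\<close>
  for the first, \<open>(z, q)\<close> from the exchange for the second. The condition
  \<open>r z \<le> x\<close> is what makes \<open>z\<close> admissible against
  \<open>v\<close>.\<close>

lemma pairwise_gap:
  assumes "simplex_like C" "x \<in> C" "y \<in> C"
    and "p \<in> argmins (\<lambda>p. gradient f x \<bullet> (p - x)) C"
    and "v \<in> argmins (away_objective f x) C"
  shows "gradient f x \<bullet> (x - y) \<le> gradient f x \<bullet> (v - p)"
    and "gradient f x \<bullet> (x - y)
      \<le> sqrt (real (card (vec_supp y))) * norm (x - y) * (gradient f x \<bullet> (v - p))"
proof -
  let ?g = "gradient f x"
  have p: "?g \<bullet> p \<le> ?g \<bullet> u" if "u \<in> C" for u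
    using assms(4) that by (auto simp: in_argmins_iff inner_diff_right)
  have v: "?g \<bullet> z \<le> ?g \<bullet> v" if "z \<in> C" "vec_supp z \<subseteq> vec_supp x" for z
    using away_vertex(3)[OF assms(1,2,5) that] .
  show "?g \<bullet> (x - y) \<le> ?g \<bullet> (v - p)"
    using p[OF assms(3)] v[OF assms(2)] by (simp add: inner_diff_right)
  have "v \<in> C" using away_vertex(1)[OF assms(1,2,5)] .
  obtain r z q where rzq: "0 \<le> r" "z \<in> C" "q \<in> C" "x - y = r *\<^sub>R (z - q)" "\<And>i. r * z $ i \<le> x $ i"
    "r \<le> sqrt (real (card (vec_supp y))) * norm (x - y)"
    using simplex_like_exchange[OF assms(1-3)] by metis
  have gap: "0 \<le> ?g \<bullet> (v - p)"
    using p[OF \<open>v \<in> C\<close>] by (simp add: inner_diff_right)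
  \<comment> \<open>For \<open>r = 0\<close> nothing is known about the support of \<open>z\<close>,
    but then \<open>x = y\<close>.\<close>
  have "?g \<bullet> (x - y) \<le> r * (?g \<bullet> (v - p))"
  proof (cases "r = 0")
    case True
    then show ?thesis using rzq(4) by simp
  next
    case False
    have "vec_supp z \<subseteq> vec_supp x"
    proof
      fix i assume "i \<in> vec_supp z"
      then have "0 < r * z $ i"
        using simplex_like_nonneg[OF assms(1) rzq(2), of i] rzq(1) False
        by (simp add: vec_supp_def less_le)
      then show "i \<in> vec_supp x" using rzq(5)[of i] by (auto simp: vec_supp_def)
    qed
    then have "?g \<bullet> (z - q) \<le> ?g \<bullet> (v - p)"
      using p[OF rzq(3)] v[OF rzq(2)] by (simp add: inner_diff_right)
    then show ?thesis using rzq(1,4) by (simp add: mult_left_mono)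
  qed
  also have "\<dots> \<le> sqrt (real (card (vec_supp y))) * norm (x - y) * (?g \<bullet> (v - p))"
    using rzq(6) gap by (rule mult_right_mono)
  finally show "?g \<bullet> (x - y) \<le> sqrt (real (card (vec_supp y))) * norm (x - y) * (?g \<bullet> (v - p))" .
qed

section \<open>Gradients and convexity\<close>

text \<open>This justifies the \<open>THE\<close> in \<open>gradient\<close>: the adjoint of the
  derivative, applied to 1, represents it, and derivatives are unique.\<close>

lemma has_derivative_gradient:
  assumes "f differentiable (at x)"
  shows "(f has_derivative (\<lambda>h. h \<bullet> gradient f x)) (at (x::'a::euclidean_space))"
proof -
  obtain f' where f': "(f has_derivative f') (at x)"
    using assms by (auto simp: differentiable_def)
  define g where "g = adjoint f' 1"
  have "f' = (\<lambda>h. h \<bullet> g)"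
    using adjoint_works[OF has_derivative_linear[OF f'], of _ 1] by (auto simp: g_def)
  then have g: "GDERIV f x :> g"
    using f' by (simp add: gderiv_def)
  have "gradient f x = g"
    unfolding gradient_def
  proof (rule the_equality)
    fix g' assume "GDERIV f x :> g'"
    then have "(\<lambda>h. h \<bullet> g') = (\<lambda>h. h \<bullet> g)"
      using g unfolding gderiv_def by (rule has_derivative_unique)
    then show "g' = g"
      unfolding fun_eq_iff vector_eq_ldot .
  qed (fact g)
  then show ?thesis
    using g by (simp add: gderiv_def)
qed

text \<open>By convexity the difference quotients along the segment from \<open>x\<close> to
  \<open>y\<close> are at most \<open>f y - f x\<close>; their one-sided limit at 0 is the
  directional derivative.\<close>

lemma convex_on_above_gradient:
  fixes f :: "'a::euclidean_space \<Rightarrow> real"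
  assumes "convex_on C f" "f differentiable (at x)" "x \<in> C" "y \<in> C"
  shows "f x + gradient f x \<bullet> (y - x) \<le> f y"
proof -
  define \<phi> where "\<phi> = (\<lambda>s::real. f (x + s *\<^sub>R (y - x)))"
  have "(\<phi> has_real_derivative gradient f x \<bullet> (y - x)) (at 0)"
  proof -
    have "((\<lambda>s::real. x + s *\<^sub>R (y - x)) has_derivative (\<lambda>s. s *\<^sub>R (y - x))) (at 0)"
      by (auto intro!: derivative_eq_intros)
    then have "(\<phi> has_derivative (\<lambda>s. (s *\<^sub>R (y - x)) \<bullet> gradient f x)) (at 0)"
      unfolding \<phi>_def by (rule has_derivative_compose) (simp add: has_derivative_gradient[OF assms(2)])
    then show ?thesis
      by (rule has_derivative_imp_has_field_derivative) (simp add: inner_commute mult.commute)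
  qed
  then have "((\<lambda>s. (\<phi> s - \<phi> 0) / s) \<longlongrightarrow> gradient f x \<bullet> (y - x)) (at_right 0)"
    by (auto simp: has_field_derivative_iff intro: tendsto_mono[OF at_le])
  moreover have "\<forall>\<^sub>F s in at_right 0. (\<phi> s - \<phi> 0) / s \<le> f y - f x"
    unfolding eventually_at_right_field
  proof (intro exI[of _ 1] conjI allI impI)
    fix s :: real assume s: "0 < s" "s < 1"
    have "\<phi> s = f ((1 - s) *\<^sub>R x + s *\<^sub>R y)"
      by (simp add: \<phi>_def algebra_simps)
    also have "\<dots> \<le> (1 - s) * f x + s * f y"
      using convex_onD[OF assms(1)] s assms(3,4) by simp
    finally show "(\<phi> s - \<phi> 0) / s \<le> f y - f x"
      using s by (simp add: \<phi>_def field_simps)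
  qed simp
  ultimately have "gradient f x \<bullet> (y - x) \<le> f y - f x"
    by (rule tendsto_upperbound) simp
  then show ?thesis by simp
qed

section \<open>Dyadic step sizes\<close>

lemma dyadic_step_bounds:
  assumes "0 < \<eta>" "\<eta> \<le> 1"
  shows "0 < dyadic_step \<eta>" "dyadic_step \<eta> \<le> \<eta>" "\<eta> / 2 \<le> dyadic_step \<eta>"
proof -
  define k where "k = (LEAST k::nat. (1 / 2) ^ k \<le> \<eta>)"
  have "\<exists>k::nat. (1 / 2) ^ k \<le> \<eta>"
    using real_arch_pow_inv[OF assms(1), of "1/2"] by (auto intro: less_imp_le)
  then have "(1 / 2) ^ k \<le> \<eta>"
    unfolding k_def by (rule LeastI_ex)
  moreover have "\<eta> / 2 \<le> (1 / 2) ^ k"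
  proof (cases k)
    case (Suc j)
    then have "\<not> (1 / 2) ^ j \<le> \<eta>"
      using not_less_Least[of j "\<lambda>k. (1 / 2) ^ k \<le> \<eta>"] by (simp add: k_def)
    then show ?thesis using Suc by simp
  qed (use assms in simp)
  ultimately show "0 < dyadic_step \<eta>" "dyadic_step \<eta> \<le> \<eta>" "\<eta> / 2 \<le> dyadic_step \<eta>"
    by (simp_all add: dyadic_step_def k_def)
qed

text \<open>A smaller bound needs a larger exponent, so the ratio of the steps is a power of 2.
  Hence the grids of step sizes are nested.\<close>

lemma dyadic_step_multiple:
  assumes "0 < \<eta>'" "\<eta>' \<le> \<eta>"
  obtains n :: nat where "dyadic_step \<eta> = real n * dyadic_step \<eta>'"
proof -
  define k where "k = (LEAST k::nat. (1 / 2) ^ k \<le> \<eta>)"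
  define k' where "k' = (LEAST k::nat. (1 / 2) ^ k \<le> \<eta>')"
  have "\<exists>k::nat. (1 / 2) ^ k \<le> \<eta>'"
    using real_arch_pow_inv[OF assms(1), of "1/2"] by (auto intro: less_imp_le)
  then have "(1 / 2) ^ k' \<le> \<eta>'"
    unfolding k'_def by (rule LeastI_ex)
  then have "k \<le> k'"
    unfolding k_def using assms(2) by (intro Least_le) simp
  then have "(1 / 2 :: real) ^ k = real (2 ^ (k' - k)) * (1 / 2) ^ k'"
    by (simp add: power_one_over field_simps flip: power_add)
  then show ?thesis
    using that by (simp add: dyadic_step_def k_def k'_def)
qed

section \<open>The scalar recursion\<close>

text \<open>Since \<open>p/2 \<le> 1\<close>, \<open>r \<le> r powr (p/2)\<close>, so contraction by
  \<open>r\<close> carries the bound at \<open>e\<close> to the bound at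
  \<open>r * e\<close>.\<close>

lemma rate_step_geometric:
  fixes e r p M B h :: real
  assumes "0 \<le> e" "0 \<le> r" "r \<le> 1" "1 \<le> p" "p \<le> 2" "0 \<le> M"
    and "h \<le> max (e powr (p/2) * M) (e powr (p/2) * B powr p + e * M)"
  shows "r * h \<le> max ((r * e) powr (p/2) * M) ((r * e) powr (p/2) * B powr p + (r * e) * M)"
proof -
  have "r \<le> r powr (p/2)"
  proof (cases "r = 0")
    case False
    then have "r powr 1 \<le> r powr (p/2)"
      using assms by (intro powr_mono') auto
    then show ?thesis using False assms(2) by simp
  qed simp
  then have le: "r * e powr (p/2) \<le> (r * e) powr (p/2)"
    using assms(1,2) by (simp add: powr_mult mult_right_mono)
  have "r * h \<le> r * max (e powr (p/2) * M) (e powr (p/2) * B powr p + e * M)"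
    using assms(2,7) by (rule mult_left_mono[rotated])
  also have "\<dots> = max ((r * e powr (p/2)) * M) ((r * e powr (p/2)) * B powr p + (r * e) * M)"
    using assms(2) by (simp add: max_mult_distrib_left algebra_simps)
  also have "\<dots> \<le> max ((r * e) powr (p/2) * M) ((r * e) powr (p/2) * B powr p + (r * e) * M)"
    using le assms(6) by (intro max.mono add_mono mult_right_mono order_refl) auto
  finally show ?thesis .
qed

text \<open>\<open>e t\<close> is the product of the step sizes \<open>8 / (s + 8)\<close> at
  \<open>s = t - 1\<close> and \<open>s = t - 2\<close>. A contraction multiplies the bound as in
  \<open>rate_step_geometric\<close>; in the other alternative the bound at \<open>t + 1\<close>
  follows without the induction hypothesis.\<close>

lemma open_loop_rate:
  fixes h :: "nat \<Rightarrow> real" and e :: "nat \<Rightarrow> real"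
  assumes "1 \<le> p" "p \<le> 2" "0 \<le> M" "0 \<le> B"
    and e: "\<And>t. e t = 64 / ((real t + 6) * (real t + 7))"
    and h_1: "1 \<le> T \<Longrightarrow> h 1 \<le> M"
    and step: "\<And>t. t \<in> {1..<T} \<Longrightarrow>
      (h t \<le> (8 / (real t + 8) * B) powr p \<and> h (t + 1) \<le> h t + (8 / (real t + 8))\<^sup>2 * M)
      \<or> h (t + 1) \<le> (real t + 6) / (real t + 8) * h t"
    and t: "1 \<le> t" "t \<le> T"
  shows "h t \<le> max (e t powr (p/2) * M) (e t powr (p/2) * B powr p + e t * M)"
  using t
proof (induction t rule: dec_induct)
  case base
  \<comment> \<open>Since \<open>e 1\<close> exceeds 1, the first term of the maximum already
    dominates \<open>M\<close>.\<close>
  have "e 1 = 8/7" by (simp add: e)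
  then have "1 \<le> e 1 powr (p/2)"
    using assms(1) by (intro ge_one_powr_ge_zero) auto
  then have "M \<le> e 1 powr (p/2) * M"
    using mult_right_mono[of 1 "e 1 powr (p/2)" M] assms(3) by simp
  then show ?case using h_1 base by simp
next
  case (step t)
  have t: "t \<in> {1..<T}" using step.hyps step.prems by auto
  \<comment> \<open>The factor \<open>real t + 7\<close> cancels in the quotient of consecutive
    values of \<open>e\<close>.\<close>
  have e_Suc: "e (Suc t) = (real t + 6) / (real t + 8) * e t"
  proof -
    have "64 / ((a + 1) * (a + 2)) = a / (a + 2) * (64 / (a * (a + 1)))" if "0 < a" for a :: real
      using that by simp
    from this[of "real t + 6"] show ?thesis
      by (simp add: e add_ac)
  qed
  from assms(7)[OF t] show ?case
  proof
    assume *: "h (t + 1) \<le> (real t + 6) / (real t + 8) * h t"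
    have "(real t + 6) / (real t + 8) * h t
      \<le> max (e (Suc t) powr (p/2) * M) (e (Suc t) powr (p/2) * B powr p + e (Suc t) * M)"
      unfolding e_Suc
      using assms(1-3) step.IH step.prems
      by (intro rate_step_geometric) (auto simp: e)
    with * show ?thesis by simp
  next
    assume *: "h t \<le> (8 / (real t + 8) * B) powr p \<and> h (t + 1) \<le> h t + (8 / (real t + 8))\<^sup>2 * M"
    have sq: "(8 / (real t + 8))\<^sup>2 \<le> e (Suc t)"
    proof -
      have "(8 / (real t + 8))\<^sup>2 = 64 / ((real t + 8) * (real t + 8))"
        by (simp add: power2_eq_square)
      also have "\<dots> \<le> 64 / ((real (Suc t) + 6) * (real (Suc t) + 7))"
        by (intro divide_left_mono mult_mono) auto
      finally show ?thesis unfolding e .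
    qed
    have "c\<^sup>2 powr (p/2) = c powr p" if "0 < c" for c :: real
      using powr_powr[of c 2 "p/2"] that by simp
    from this[of "8 / (real t + 8)"]
    have "(8 / (real t + 8) * B) powr p = ((8 / (real t + 8))\<^sup>2) powr (p/2) * B powr p"
      using powr_mult[of "8 / (real t + 8)" B p] assms(4) by (simp only: zero_le_divide_iff) simp
    also have "\<dots> \<le> e (Suc t) powr (p/2) * B powr p"
      using sq assms(1) by (intro mult_right_mono powr_mono2) auto
    finally have "h (t + 1) \<le> e (Suc t) powr (p/2) * B powr p + e (Suc t) * M"
      using * mult_right_mono[OF sq assms(3)] by linarith
    then show ?thesis by simp
  qed
qed

section \<open>Feasibility of the iterates\<close>

text \<open>The grid condition gives feasibility: a positive entry of \<open>x t\<close> is at least the step size.\<close>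

lemma difw_iterate_invariant:
  assumes C: "simplex_like C" and difw: "difw_iterates C f s T x"
    and s: "\<And>t. 0 < s t" "\<And>t. s t \<le> 1" "\<And>t. s (Suc t) \<le> s t"
    and t: "1 \<le> t" "t \<le> T"
  shows "x t \<in> C \<and> (\<forall>i. \<exists>k::int. x t $ i = of_int k * dyadic_step (s t))"
  using t
proof (induction t rule: dec_induct)
  case base
  have x1: "x 1 \<in> vertices C"
    using difw by (simp add: difw_iterates_def)
  then have "x 1 \<in> C"
    by (rule simplex_like_vertex(1)[OF C])
  moreover have "\<exists>k::int. x 1 $ i = of_int k * dyadic_step (s 1)" for i
  proof -
    \<comment> \<open>Step size 1 gives the integer grid, so Boolean vertices lie on every dyadic
      grid.\<close>
    have "dyadic_step 1 = 1"
      by (simp add: dyadic_step_def Least_eq_0)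
    then obtain n :: nat where n: "1 = real n * dyadic_step (s 1)"
      using dyadic_step_multiple[OF s(1,2)] by metis
    have "x 1 $ i = 0 \<or> x 1 $ i = 1"
      using simplex_like_vertex(2)[OF C x1] .
    then show ?thesis
    proof
      assume "x 1 $ i = 0"
      then show ?thesis by (intro exI[of _ 0]) simp
    next
      assume "x 1 $ i = 1"
      then show ?thesis using n by (intro exI[of _ "int n"]) simp
    qed
  qed
  ultimately show ?case by simp
next
  case (step t)
  define \<gamma> where "\<gamma> = dyadic_step (s t)"
  have "0 < \<gamma>"
    unfolding \<gamma>_def by (rule dyadic_step_bounds(1)[OF s(1,2)])
  have xt: "x t \<in> C" and grid: "\<exists>k::int. x t $ i = of_int k * \<gamma>" for i
    using step.IH step.prems by (simp_all add: \<gamma>_def)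
  have "t \<in> {1..<T}" using step by auto
  then obtain p v where p: "p \<in> vertices C"
    and v: "v \<in> vertices C" "v \<in> argmins (away_objective f (x t)) C"
    and x_Suc: "x (Suc t) = x t + \<gamma> *\<^sub>R (p - v)"
    using difw unfolding difw_iterates_def \<gamma>_def by fastforce
  have pvC: "p \<in> C" "v \<in> C"
    using p v simplex_like_vertex(1)[OF C] by auto
  note bool = simplex_like_vertex(2)[OF C]
  have comp: "(x t + \<gamma> *\<^sub>R (p - v)) $ i = x t $ i + \<gamma> * p $ i - \<gamma> * v $ i" for i
    by (simp add: algebra_simps)
  have "0 \<le> (x t + \<gamma> *\<^sub>R (p - v)) $ i" for i
  proof -
    have "0 \<le> \<gamma> * p $ i"
      using simplex_like_nonneg[OF C pvC(1)] \<open>0 < \<gamma>\<close> by simp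
    moreover have "\<gamma> * v $ i \<le> x t $ i"
      using bool[OF v(1), of i]
    proof
      assume "v $ i = 0"
      then show ?thesis using simplex_like_nonneg[OF C xt] by simp
    next
      assume vi: "v $ i = 1"
      then have "x t $ i \<noteq> 0"
        using subsetD[OF away_vertex(2)[OF C xt v(2)], of i] by (simp add: vec_supp_def)
      then have pos: "0 < x t $ i"
        using simplex_like_nonneg[OF C xt, of i] by simp
      obtain k :: int where k: "x t $ i = of_int k * \<gamma>"
        using grid by blast
      then have "0 < k"
        using pos \<open>0 < \<gamma>\<close> by (simp add: zero_less_mult_iff)
      then have "1 \<le> real_of_int k" by linarith
      then have "1 * \<gamma> \<le> of_int k * \<gamma>"
        using \<open>0 < \<gamma>\<close> by (intro mult_right_mono) auto
      then show ?thesis using k vi by simp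
    qed
    ultimately show ?thesis unfolding comp by linarith
  qed
  then have "x (Suc t) \<in> C"
    unfolding x_Suc by (intro simplex_like_shift[OF C xt pvC])
  \<comment> \<open>Boolean \<open>p\<close> and \<open>v\<close> keep the new point on the grid of
    \<open>\<gamma>\<close>, which the next grid refines.\<close>
  moreover have "\<exists>k::int. x (Suc t) $ i = of_int k * dyadic_step (s (Suc t))" for i
  proof -
    obtain n :: nat where n: "\<gamma> = real n * dyadic_step (s (Suc t))"
      unfolding \<gamma>_def using dyadic_step_multiple[OF s(1,3)] by metis
    obtain k :: int where k: "x t $ i = of_int k * \<gamma>"
      using grid by blast
    have int: "\<exists>a::int. u $ i = of_int a" if "u \<in> vertices C" for u
      using bool[OF that, of i] by (metis of_int_0 of_int_1)
    obtain a b :: int where "p $ i = of_int a" "v $ i = of_int b"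
      using int[OF p] int[OF v(1)] by blast
    then have "x (Suc t) $ i = of_int (k + a - b) * \<gamma>"
      unfolding x_Suc comp k by (simp add: algebra_simps)
    also have "\<dots> = of_int ((k + a - b) * int n) * dyadic_step (s (Suc t))"
      by (subst n) simp
    finally show ?thesis by blast
  qed
  ultimately show ?case by simp
qed

section \<open>One-step decrease\<close>

lemma descent_dichotomy:
  fixes h h' G \<gamma> \<eta> M K \<theta> :: real
  assumes \<eta>: "0 < \<eta>" "\<eta> / 2 \<le> \<gamma>" "\<gamma> \<le> \<eta>"
    and nonneg: "0 \<le> M" "0 \<le> K" "0 \<le> h" and \<theta>: "\<theta> < 1"
    and gap: "h \<le> G" "h \<le> K * h powr \<theta> * G"
    and descent: "h' \<le> h - \<gamma> * G + \<gamma>\<^sup>2 * M"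
  shows "(h \<le> (\<eta> * (4 * M * K)) powr (1 / (1 - \<theta>)) \<and> h' \<le> h + \<eta>\<^sup>2 * M) \<or> h' \<le> (1 - \<eta> / 4) * h"
proof (cases "h powr (1 - \<theta>) \<le> \<eta> * (4 * M * K)")
  case True
  have "h = (h powr (1 - \<theta>)) powr (1 / (1 - \<theta>))"
    using \<theta> nonneg(3) by (simp add: powr_powr)
  also have "\<dots> \<le> (\<eta> * (4 * M * K)) powr (1 / (1 - \<theta>))"
    using True \<theta> by (intro powr_mono2) auto
  finally have "h \<le> (\<eta> * (4 * M * K)) powr (1 / (1 - \<theta>))" .
  moreover have "h' \<le> h + \<eta>\<^sup>2 * M"
  proof -
    have "0 \<le> \<gamma> * G" using \<eta> gap(1) nonneg by simp
    moreover have "\<gamma>\<^sup>2 * M \<le> \<eta>\<^sup>2 * M"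
      using \<eta> nonneg by (intro mult_right_mono power_mono) auto
    ultimately show ?thesis using descent by linarith
  qed
  ultimately show ?thesis by blast
next
  case False
  have "0 \<le> \<eta> * (4 * M * K)" using \<eta> nonneg by simp
  with False have "h \<noteq> 0" by auto
  then have "0 < h" using nonneg(3) by simp
  have "h powr (1 - \<theta>) = h / h powr \<theta>"
    using \<open>0 < h\<close> by (simp add: powr_diff)
  also have "\<dots> \<le> K * G"
    using gap(2) \<open>0 < h\<close> by (simp add: pos_divide_le_eq mult_ac)
  finally have "K * (4 * M * \<eta>) < K * G"
    using False by (simp add: mult_ac)
  \<comment> \<open>Strictness rules out \<open>K = 0\<close>, so \<open>K\<close> can be
    cancelled.\<close>
  then have "4 * M * \<eta> < G"
    using nonneg(2) by (simp add: mult_less_cancel_left_disj)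
  moreover have "\<gamma> * M \<le> \<eta> * M"
    using \<eta>(3) nonneg(1) by (rule mult_right_mono)
  ultimately have "\<gamma> * (\<gamma> * M) \<le> \<gamma> * (G / 4)"
    using \<eta>(1,2) by (intro mult_left_mono) (auto simp: algebra_simps)
  moreover have "\<eta> / 2 * h \<le> \<gamma> * G"
    using \<eta> gap(1) nonneg by (intro mult_mono) auto
  \<comment> \<open>The quadratic term costs at most a quarter of \<open>\<gamma> * G\<close>; what
    remains is \<open>3/8 * \<eta> * h\<close>, more than the claimed
    \<open>\<eta> / 4 * h\<close>.\<close>
  ultimately have "h' \<le> h - 3/4 * (\<eta> / 2 * h)"
    using descent by (simp add: power2_eq_square algebra_simps)
  also have "\<dots> \<le> (1 - \<eta> / 4) * h"
    using \<open>0 < h\<close> \<eta>(1) by (simp add: algebra_simps)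
  finally show ?thesis by blast
qed

section \<open>Convergence rate of DIFW\<close>

theorem theorem5p3:
  fixes C :: "(real ^ 'n) set" and f :: "real ^ 'n \<Rightarrow> real"
    and xs :: "real ^ 'n" and x :: "nat \<Rightarrow> real ^ 'n"
    and L \<mu> \<theta> \<delta> :: real and \<eta> :: "int \<Rightarrow> real" and T :: nat
  assumes "simplex_like C"
    and "\<delta> = diameter C" and "\<delta> > 0"
    and "convex_on C f"
    and "L_smooth_on C L f"
    and "argmins f C = {xs}"
    and "\<mu> > 0" and "\<theta> \<in> {0..1/2}"
    and "holder_error_bound C f xs \<mu> \<theta>"
    and "\<And>t. \<eta> t = 8 / (of_int t + 8)"
    and "difw_iterates C f (\<lambda>t. \<eta> (int t)) T x"
  shows "\<forall>t\<in>{1..T}. f (x t) - f xs \<le>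
    max (\<eta> (int t - 2) powr (1 / (1 - \<theta>)) * (L * \<delta>\<^sup>2 / 2))
        ((\<eta> (int t - 2) * (2 * \<mu> * L * \<delta>\<^sup>2 * sqrt (real (card (vec_supp xs))))) powr (1 / (1 - \<theta>))
          + (\<eta> (int t - 2))\<^sup>2 * (L * \<delta>\<^sup>2 / 2))"
proof
  \<comment> \<open>\<open>s\<close> is \<open>\<eta>\<close> on the naturals, \<open>M\<close>
    bounds the quadratic term of a full step, and \<open>K\<close> combines the support factor with
    the error bound constant.\<close>
  define s where "s t = 8 / (real t + 8)" for t
  define M where "M = L * \<delta>\<^sup>2 / 2"
  define K where "K = sqrt (real (card (vec_supp xs))) * \<mu>"
  define p where "p = 1 / (1 - \<theta>)"
  define h where "h t = f (x t) - f xs" for t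
  define e where "e t = 64 / ((real t + 6) * (real t + 7))" for t :: nat
  have \<theta>: "0 \<le> \<theta>" "\<theta> \<le> 1/2" using assms(8) by auto
  have p: "1 \<le> p" "p \<le> 2" using \<theta> by (auto simp: p_def field_simps)
  have L: "0 < L" and smooth: "\<And>a b. \<lbrakk>a \<in> C; b \<in> C\<rbrakk> \<Longrightarrow>
      f b \<le> f a + gradient f a \<bullet> (b - a) + L / 2 * (norm (a - b))\<^sup>2"
    and diff: "\<And>a. a \<in> C \<Longrightarrow> f differentiable (at a)"
    using assms(5) unfolding L_smooth_on_def by blast+
  have MK: "0 \<le> M" "0 \<le> K" using L assms(7) by (simp_all add: M_def K_def)
  have xs: "xs \<in> C" and xs_min: "\<And>a. a \<in> C \<Longrightarrow> f xs \<le> f a"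
    using assms(6) in_argmins_iff[of xs f C] by auto
  have diam: "norm (a - b) \<le> \<delta>" if "a \<in> C" "b \<in> C" for a b
    using diameter_bounded_bound[of C a b] that assms(1,2)
    by (simp add: simplex_like_def polytope_imp_bounded dist_norm)
  have quad: "L / 2 * (norm (\<gamma> *\<^sub>R (a - b)))\<^sup>2 \<le> \<gamma>\<^sup>2 * M" if "a \<in> C" "b \<in> C" for a b \<gamma>
  proof -
    have "(norm (a - b))\<^sup>2 \<le> \<delta>\<^sup>2"
      using diam[OF that] by (intro power_mono) auto
    then have "\<gamma>\<^sup>2 * (L / 2 * (norm (a - b))\<^sup>2) \<le> \<gamma>\<^sup>2 * (L / 2 * \<delta>\<^sup>2)"
      using L by (intro mult_left_mono) auto
    then show ?thesis by (simp add: M_def power_mult_distrib mult_ac)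
  qed
  have subgradient: "f a - f xs \<le> gradient f a \<bullet> (a - xs)" if "a \<in> C" for a
    using convex_on_above_gradient[OF assms(4) diff[OF that] that xs] by (simp add: inner_diff_right)
  have s: "0 < s t" "s t \<le> 1" "s (Suc t) \<le> s t" for t
    by (auto simp: s_def intro!: divide_left_mono)
  have difw: "difw_iterates C f s T x"
    using assms(11) by (simp add: assms(10) s_def[abs_def])
  have in_C: "x t \<in> C" if "t \<in> {1..T}" for t
    using difw_iterate_invariant[OF assms(1) difw s] that by simp
  have h_nonneg: "0 \<le> h t" if "t \<in> {1..T}" for t
    using xs_min[OF in_C[OF that]] by (simp add: h_def)
  \<comment> \<open>The first iterate is the end of a full step: its linear term is at most that of
    \<open>xs\<close>, which convexity bounds by \<open>f xs - f (x 0)\<close>.\<close>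
  have h_1: "h 1 \<le> M"
  proof -
    have x01: "x 0 \<in> C" "x 1 \<in> C" "gradient f (x 0) \<bullet> (x 1 - x 0) \<le> gradient f (x 0) \<bullet> (xs - x 0)"
      using difw xs by (auto simp: difw_iterates_def in_argmins_iff)
    then have "f (x 1) \<le> f (x 0) + gradient f (x 0) \<bullet> (xs - x 0) + M"
      using smooth[OF x01(1,2)] quad[OF x01(1,2), of 1] by simp
    also have "\<dots> \<le> f xs + M"
      using subgradient[OF x01(1)] by (simp add: inner_diff_right)
    finally show ?thesis by (simp add: h_def)
  qed
  have step: "(h t \<le> (s t * (4 * M * K)) powr p \<and> h (t + 1) \<le> h t + (s t)\<^sup>2 * M)
      \<or> h (t + 1) \<le> (real t + 6) / (real t + 8) * h t" if t: "t \<in> {1..<T}" for t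
  proof -
    have xC: "x t \<in> C" "x (t + 1) \<in> C" "0 \<le> h t" using in_C h_nonneg t by auto
    define \<gamma> where "\<gamma> = dyadic_step (s t)"
    let ?g = "gradient f (x t)"
    obtain q v where q: "q \<in> C" "q \<in> argmins (\<lambda>q. ?g \<bullet> (q - x t)) C"
      and v: "v \<in> C" "v \<in> argmins (away_objective f (x t)) C"
      and x_Suc: "x (t + 1) = x t + \<gamma> *\<^sub>R (q - v)"
      using difw t unfolding difw_iterates_def \<gamma>_def
      by (metis IntD2 in_argmins_iff)
    define G where "G = ?g \<bullet> (v - q)"
    have gap: "h t \<le> G"
      using pairwise_gap(1)[OF assms(1) xC(1) xs q(2) v(2)] subgradient[OF xC(1)]
      by (simp add: G_def h_def)
    have "h t \<le> sqrt (real (card (vec_supp xs))) * norm (x t - xs) * G"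
      using pairwise_gap(2)[OF assms(1) xC(1) xs q(2) v(2)] subgradient[OF xC(1)]
      by (simp add: G_def h_def)
    \<comment> \<open>The error bound replaces the distance to \<open>xs\<close> by a power of
      \<open>h t\<close>.\<close>
    also have "\<dots> \<le> sqrt (real (card (vec_supp xs))) * (\<mu> * h t powr \<theta>) * G"
      using assms(9) xC(1,3) gap
      by (intro mult_right_mono mult_left_mono) (auto simp: holder_error_bound_def h_def)
    finally have "h t \<le> K * h t powr \<theta> * G"
      by (simp add: K_def mult_ac)
    moreover have "h (t + 1) \<le> h t - \<gamma> * G + \<gamma>\<^sup>2 * M"
    proof -
      have diff: "x (t + 1) - x t = \<gamma> *\<^sub>R (q - v)" "x t - x (t + 1) = \<gamma> *\<^sub>R (v - q)"
        unfolding x_Suc by (simp_all add: scaleR_right_diff_distrib)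
      have "f (x (t + 1)) \<le> f (x t) + \<gamma> * (?g \<bullet> (q - v)) + \<gamma>\<^sup>2 * M"
        using smooth[OF xC(1,2)] quad[OF v(1) q(1), of \<gamma>] unfolding diff by simp
      then show ?thesis by (simp add: h_def G_def inner_diff_right algebra_simps)
    qed
    ultimately have "(h t \<le> (s t * (4 * M * K)) powr p \<and> h (t + 1) \<le> h t + (s t)\<^sup>2 * M)
        \<or> h (t + 1) \<le> (1 - s t / 4) * h t"
      unfolding p_def using dyadic_step_bounds[OF s(1,2)] s(1) MK xC(3) \<theta> gap
      by (intro descent_dichotomy) (auto simp: \<gamma>_def)
    moreover have "1 - s t / 4 = (real t + 6) / (real t + 8)"
      by (simp add: s_def field_simps)
    ultimately show ?thesis by simp
  qed
  fix t assume t: "t \<in> {1..T}"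
  define a where "a = \<eta> (int t - 2)"
  have a: "a = 8 / (real t + 6)" "0 < a" by (simp_all add: a_def assms(10))
  have "h t \<le> max (e t powr (p/2) * M) (e t powr (p/2) * (4 * M * K) powr p + e t * M)"
  proof (rule open_loop_rate)
    show "(h t \<le> (8 / (real t + 8) * (4 * M * K)) powr p \<and> h (t + 1) \<le> h t + (8 / (real t + 8))\<^sup>2 * M)
      \<or> h (t + 1) \<le> (real t + 6) / (real t + 8) * h t" if "t \<in> {1..<T}" for t
      using step[OF that] unfolding s_def .
  qed (use p MK h_1 t in \<open>simp_all add: e_def\<close>)
  \<comment> \<open>Replacing the step size at \<open>t - 1\<close> by the larger \<open>a\<close>
    turns \<open>e t\<close> into the square of \<open>a\<close>.\<close>
  also have "\<dots> \<le> max (a powr p * M) (a powr p * (4 * M * K) powr p + a\<^sup>2 * M)"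
  proof -
    have "e t \<le> 64 / ((real t + 6) * (real t + 6))"
      unfolding e_def by (intro divide_left_mono mult_mono) auto
    also have "\<dots> = a\<^sup>2" by (simp add: a(1) power2_eq_square)
    finally have e_le: "e t \<le> a\<^sup>2" .
    then have "e t powr (p/2) \<le> (a\<^sup>2) powr (p/2)"
      using p by (intro powr_mono2) (auto simp: e_def)
    also have "\<dots> = a powr p"
      using powr_powr[of a 2 "p/2"] a(2) by simp
    finally show ?thesis
      using e_le MK by (intro max.mono add_mono mult_right_mono) auto
  qed
  \<comment> \<open>Unfolding \<open>M\<close> and \<open>K\<close> in \<open>4 * M * K\<close>
    gives the constant of the statement.\<close>
  also have "a powr p * (4 * M * K) powr p = (a * (2 * \<mu> * L * \<delta>\<^sup>2 * sqrt (real (card (vec_supp xs))))) powr p"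
    using powr_mult[of a "4 * M * K" p] a(2) MK by (simp add: M_def K_def mult_ac)
  finally show "f (x t) - f xs \<le>
    max (\<eta> (int t - 2) powr (1 / (1 - \<theta>)) * (L * \<delta>\<^sup>2 / 2))
        ((\<eta> (int t - 2) * (2 * \<mu> * L * \<delta>\<^sup>2 * sqrt (real (card (vec_supp xs))))) powr (1 / (1 - \<theta>))
          + (\<eta> (int t - 2))\<^sup>2 * (L * \<delta>\<^sup>2 / 2))"
    by (simp add: h_def p_def a_def M_def)
qed

end
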